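(* Let $F$ be a field, let $n\in\{2,3\}$, let $A=(a_{ijk})_{1\le i,j,k\le n}$ be a cubic-matrix of order $n$ over $F$, and let $\alpha\in F$ with $\alpha\neq 0$. Let $B$ be the cubic-matrix of order $n$ obtained from $A$ by multiplying all entries of any single horizontal layer (fixed value of $i$), or any single vertical page (fixed value of $j$), or any single vertical layer (fixed value of $k$) by $\alpha$, leaving all other entries unchanged. Then $\det(B)=\alpha\cdot\det(A)$, where $\det$ denotes the determinant of cubic-matrices of order 2 and 3 defined in the context.
   Context: A cubic-matrix of order $n$ over a field $F$ is a family $A=(a_{ijk})_{1\le i,j,k\le n}$ with $a_{ijk}\in F$. Fixing the index $i$ gives a "horizontal layer", fixing $j$ gives a "vertical page", fixing $k$ gives a "vertical layer". For a cubic-matrix $A$ of order 2 the determinant is the scalar $$\det(A)=a_{111}a_{222}-a_{112}a_{221}-a_{121}a_{212}+a_{122}a_{211}.$$ For a cubic-matrix $A$ of order 3 the determinant is the scalar $$\begin{aligned}\det(A)={}&a_{111}a_{222}a_{333}-a_{111}a_{232}a_{323}-a_{111}a_{223}a_{332}+a_{111}a_{233}a_{322}\\ &-a_{112}a_{221}a_{333}+a_{112}a_{223}a_{331}+a_{112}a_{231}a_{323}-a_{112}a_{233}a_{321}\\ &+a_{113}a_{221}a_{332}-a_{113}a_{222}a_{331}-a_{113}a_{231}a_{322}+a_{113}a_{232}a_{321}\\ &-a_{121}a_{212}a_{333}+a_{121}a_{213}a_{332}+a_{121}a_{232}a_{313}-a_{121}a_{233}a_{312}\\ &+a_{122}a_{211}a_{333}-a_{122}a_{213}a_{331}-a_{122}a_{231}a_{313}+a_{122}a_{233}a_{311}\\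 &-a_{123}a_{211}a_{332}+a_{123}a_{212}a_{331}+a_{123}a_{231}a_{312}-a_{123}a_{232}a_{311}\\ &+a_{131}a_{212}a_{323}-a_{131}a_{213}a_{322}-a_{131}a_{222}a_{313}+a_{131}a_{223}a_{312}\\ &-a_{132}a_{211}a_{323}+a_{132}a_{213}a_{321}+a_{132}a_{221}a_{313}-a_{132}a_{223}a_{311}\\ &+a_{133}a_{211}a_{322}-a_{133}a_{212}a_{321}-a_{133}a_{221}a_{312}+a_{133}a_{222}a_{311}.\end{aligned}$$ *)

theory Defs
  imports Main
begin

text \<open>
  A cubic-matrix of order \<open>n\<close> is represented by a function of its three indices
  \<open>i, j, k\<close>, of which only the values at indices in \<open>{1..n}\<close> are meaningful.
\<close>

type_synonym 'a cubic_matrix = "nat \<Rightarrow> nat \<Rightarrow> nat \<Rightarrow> 'a"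

definition cubic_det2 :: "'a::field cubic_matrix \<Rightarrow> 'a" where
  "cubic_det2 A =
     A 1 1 1 * A 2 2 2 - A 1 1 2 * A 2 2 1 - A 1 2 1 * A 2 1 2 + A 1 2 2 * A 2 1 1"

definition cubic_det3 :: "'a::field cubic_matrix \<Rightarrow> 'a" where
  "cubic_det3 A =
     A 1 1 1 * A 2 2 2 * A 3 3 3 - A 1 1 1 * A 2 3 2 * A 3 2 3 - A 1 1 1 * A 2 2 3 * A 3 3 2 + A 1 1 1 * A 2 3 3 * A 3 2 2
     - A 1 1 2 * A 2 2 1 * A 3 3 3 + A 1 1 2 * A 2 2 3 * A 3 3 1 + A 1 1 2 * A 2 3 1 * A 3 2 3 - A 1 1 2 * A 2 3 3 * A 3 2 1
     + A 1 1 3 * A 2 2 1 * A 3 3 2 - A 1 1 3 * A 2 2 2 * A 3 3 1 - A 1 1 3 * A 2 3 1 * A 3 2 2 + A 1 1 3 * A 2 3 2 * A 3 2 1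
     - A 1 2 1 * A 2 1 2 * A 3 3 3 + A 1 2 1 * A 2 1 3 * A 3 3 2 + A 1 2 1 * A 2 3 2 * A 3 1 3 - A 1 2 1 * A 2 3 3 * A 3 1 2
     + A 1 2 2 * A 2 1 1 * A 3 3 3 - A 1 2 2 * A 2 1 3 * A 3 3 1 - A 1 2 2 * A 2 3 1 * A 3 1 3 + A 1 2 2 * A 2 3 3 * A 3 1 1
     - A 1 2 3 * A 2 1 1 * A 3 3 2 + A 1 2 3 * A 2 1 2 * A 3 3 1 + A 1 2 3 * A 2 3 1 * A 3 1 2 - A 1 2 3 * A 2 3 2 * A 3 1 1
     + A 1 3 1 * A 2 1 2 * A 3 2 3 - A 1 3 1 * A 2 1 3 * A 3 2 2 - A 1 3 1 * A 2 2 2 * A 3 1 3 + A 1 3 1 * A 2 2 3 * A 3 1 2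
     - A 1 3 2 * A 2 1 1 * A 3 2 3 + A 1 3 2 * A 2 1 3 * A 3 2 1 + A 1 3 2 * A 2 2 1 * A 3 1 3 - A 1 3 2 * A 2 2 3 * A 3 1 1
     + A 1 3 3 * A 2 1 1 * A 3 2 2 - A 1 3 3 * A 2 1 2 * A 3 2 1 - A 1 3 3 * A 2 2 1 * A 3 1 2 + A 1 3 3 * A 2 2 2 * A 3 1 1"

text \<open>The determinant is given only for orders 2 and 3; for other orders it is left unspecified.\<close>

definition cubic_det :: "nat \<Rightarrow> 'a::field cubic_matrix \<Rightarrow> 'a" where
  "cubic_det n A = (if n = 2 then cubic_det2 A else if n = 3 then cubic_det3 A else undefined)"

definition horizontal_layer :: "nat \<Rightarrow> nat \<Rightarrow> (nat \<times> nat \<times> nat) set" where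
  "horizontal_layer n l = {(i, j, k). i = l \<and> j \<in> {1..n} \<and> k \<in> {1..n}}"

definition vertical_page :: "nat \<Rightarrow> nat \<Rightarrow> (nat \<times> nat \<times> nat) set" where
  "vertical_page n l = {(i, j, k). i \<in> {1..n} \<and> j = l \<and> k \<in> {1..n}}"

definition vertical_layer :: "nat \<Rightarrow> nat \<Rightarrow> (nat \<times> nat \<times> nat) set" where
  "vertical_layer n l = {(i, j, k). i \<in> {1..n} \<and> j \<in> {1..n} \<and> k = l}"

text \<open>
  \<open>B\<close> arises from \<open>A\<close> by multiplying the entries at the positions in \<open>S\<close> by \<open>c\<close>.
  Nothing is demanded of \<open>B\<close> outside the index range, where its values carry no information.
\<close>

definition entries_multiplied ::
  "nat \<Rightarrow> (nat \<times> nat \<times> nat) set \<Rightarrow> 'a::field \<Rightarrow> 'a cubic_matrix \<Rightarrow> 'a cubic_matrix \<Rightarrow> bool" where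
  "entries_multiplied n S c A B \<longleftrightarrow>
     (\<forall>i\<in>{1..n}. \<forall>j\<in>{1..n}. \<forall>k\<in>{1..n}.
        B i j k = (if (i, j, k) \<in> S then c * A i j k else A i j k))"

end

theory Submission
  imports Defs
begin

text \<open>In every monomial of the determinant each of the three index positions runs through a
  permutation of 1..n. A monomial therefore meets any given layer or page in exactly one factor, so
  scaling that layer or page by \<open>c\<close> scales every monomial, and hence their signed sum,
  by \<open>c\<close>. As the determinant is an explicit polynomial for each order,
  \<open>cubic_det2_entries_multiplied\<close> and \<open>cubic_det3_entries_multiplied\<close>
  check this by cases on the direction of \<open>S\<close> and the position
  \<open>l\<close>.\<close>

lemma cubic_det2_entries_multiplied:
  fixes A B :: "'a::field cubic_matrix"
  assumes "l \<in> {1..2}"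
    and "S \<in> {horizontal_layer 2 l, vertical_page 2 l, vertical_layer 2 l}"
    and "entries_multiplied 2 S c A B"
  shows "cubic_det2 B = c * cubic_det2 A"
proof -
  have entry: "B i j k = (if (i, j, k) \<in> S then c * A i j k else A i j k)"
    if "i \<in> {1..2}" "j \<in> {1..2}" "k \<in> {1..2}" for i j k
    using assms(3) that unfolding entries_multiplied_def by blast
  from assms(1) have "l = 1 \<or> l = 2" by auto
  with assms(2) show ?thesis
    unfolding cubic_det2_def
    \<comment> \<open>Three directions times two positions give six cases. In each, \<open>S\<close>
      and \<open>l\<close> are concrete, so every membership test in \<open>entry\<close> is decided
      and a polynomial identity remains.\<close>
    by (elim insertE emptyE disjE;
        simp add: entry horizontal_layer_def vertical_page_def vertical_layer_def
          algebra_simps del: One_nat_def)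
qed

lemma cubic_det3_entries_multiplied:
  fixes A B :: "'a::field cubic_matrix"
  assumes "l \<in> {1..3}"
    and "S \<in> {horizontal_layer 3 l, vertical_page 3 l, vertical_layer 3 l}"
    and "entries_multiplied 3 S c A B"
  shows "cubic_det3 B = c * cubic_det3 A"
proof -
  have entry: "B i j k = (if (i, j, k) \<in> S then c * A i j k else A i j k)"
    if "i \<in> {1..3}" "j \<in> {1..3}" "k \<in> {1..3}" for i j k
    using assms(3) that unfolding entries_multiplied_def by blast
  from assms(1) have "l = 1 \<or> l = 2 \<or> l = 3" by auto
  with assms(2) show ?thesis
    unfolding cubic_det3_def
    \<comment> \<open>Nine cases. The 36 monomials stand in the same order on both sides, so it
      suffices to distribute \<open>c\<close> over the sum and to normalise each product; the
      summands need no reordering.\<close>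
    by (elim insertE emptyE disjE;
        simp add: entry horizontal_layer_def vertical_page_def vertical_layer_def
          distrib_left right_diff_distrib mult_ac del: One_nat_def)
qed

theorem proposition2:
  fixes A B :: "'a::field cubic_matrix" and \<alpha> :: 'a and n l :: nat
    and S :: "(nat \<times> nat \<times> nat) set"
  assumes "n \<in> {2, 3}"
    and "\<alpha> \<noteq> 0"
    and "l \<in> {1..n}"
    and "S \<in> {horizontal_layer n l, vertical_page n l, vertical_layer n l}"
    and "entries_multiplied n S \<alpha> A B"
  shows "cubic_det n B = \<alpha> * cubic_det n A"
proof -
  from assms(1) consider "n = 2" | "n = 3" by auto
  then show ?thesis
  proof cases
    case 1
    then show ?thesis
      using cubic_det2_entries_multiplied assms(3-5) by (simp add: cubic_det_def)
  next
    case 2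
    then show ?thesis
      using cubic_det3_entries_multiplied assms(3-5) by (simp add: cubic_det_def)
  qed
qed

end
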